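(* Let $d\ge 2$ be an integer and let $F$ be a field of characteristic $0$ or greater than $d$. Let $\widetilde{F}=F(\alpha)$ be a field extension of $F$ of degree $d$ such that $\alpha^d=b\alpha+c$ (with $b,c\in F$), and let $\varphi=N_{\widetilde{F}/F}$ be its norm. Let $K/F$ be a quadratic field extension and let $\sigma:K\to K$ be the non-identity $F$-automorphism. Let $z_1,\dots,z_d\in K$. Then $$N_{K/F}(\varphi_K(z_1,\dots,z_d))=\varphi(A_0+cA_1,\;A_2+cA_3+bA_1,\;A_4+cA_5+bA_3,\;A_6+cA_7+bA_5,\;\dots,\;A_{2d-4}+cA_{2d-3}+bA_{2d-5},\;A_{2d-2}+bA_{2d-3})\in G_F(\varphi),$$ with $A_i\in F$ for $0\le i\le 2d-2$ defined by $$A_{2k}=\sum_{\substack{1\le i,j\le d\\ i+j=k+2}} z_i\,\sigma(z_j)\quad(0\le k\le d-1),\qquad A_{2k+1}=\sum_{\substack{1\le i,j\le d\\ i+j=d+k+2}} z_i\,\sigma(z_j)\quad(0\le k\le d-2).$$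
   Context: The norm $\varphi=N_{\widetilde F/F}$ is written in coordinates with respect to the $F$-basis $1,\alpha,\dots,\alpha^{d-1}$ of $\widetilde F$: $\varphi(x_1,\dots,x_d)=N_{\widetilde F/F}(x_1+\alpha x_2+\dots+\alpha^{d-1}x_d)$, a homogeneous polynomial of degree $d$ over $F$; $\varphi_K$ is the same polynomial considered over $K$. $G_F(\varphi)=\{a\in F^\times\mid \varphi\cong a\varphi\}$ is the group of similarity factors of $\varphi$ over $F$, where $\varphi_1\cong\varphi_2$ means that there is a bijective linear map $f$ with $\varphi_2(f(v))=\varphi_1(v)$ for all $v$.
   Formalization: The membership in G_F(φ) is claimed only when φ_K(z_1,…,z_d) ≠ 0, since otherwise the value is 0, which is not in F^× (for example z_1=…=z_d=0); the equation itself is stated for all z_1,…,z_d. *)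

theory Defs
  imports
    "HOL-Library.Poly_Mapping"
    "HOL-Computational_Algebra.Polynomial"
    "Jordan_Normal_Form.Determinant"
begin

section \<open>Field extensions\<close>

text \<open>A field extension \<open>L/F\<close> is given by a field homomorphism \<open>\<iota>\<close> from \<open>F\<close> to \<open>L\<close>
  (locale \<^locale>\<open>field_hom\<close>), so that \<open>L\<close> is an \<open>F\<close>-vector space via \<open>a \<cdot> x = \<iota> a * x\<close>.\<close>

definition ext_scale :: "('f::field \<Rightarrow> 'l::field) \<Rightarrow> 'f \<Rightarrow> 'l \<Rightarrow> 'l" where
  "ext_scale \<iota> a x = \<iota> a * x"

text \<open>\<^const>\<open>vector_space.dim\<close> is 0 for spaces of infinite dimension, so a positive value of
  \<open>ext_degree\<close> means that the extension is finite of that degree.\<close>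

definition ext_degree :: "('f::field \<Rightarrow> 'l::field) \<Rightarrow> nat" where
  "ext_degree \<iota> = vector_space.dim (ext_scale \<iota>) UNIV"

definition is_subfield :: "'l::field set \<Rightarrow> bool" where
  "is_subfield S \<longleftrightarrow> 0 \<in> S \<and> 1 \<in> S \<and>
     (\<forall>x\<in>S. \<forall>y\<in>S. x + y \<in> S \<and> x * y \<in> S) \<and> (\<forall>x\<in>S. - x \<in> S \<and> inverse x \<in> S)"

definition adjoin :: "('f::field \<Rightarrow> 'l::field) \<Rightarrow> 'l \<Rightarrow> 'l set" where
  "adjoin \<iota> \<alpha> = \<Inter> {S. is_subfield S \<and> \<iota> ` UNIV \<subseteq> S \<and> \<alpha> \<in> S}"

definition ordered_basis :: "('f::field \<Rightarrow> 'l::field) \<Rightarrow> 'l list \<Rightarrow> bool" where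
  "ordered_basis \<iota> bs \<longleftrightarrow> distinct bs \<and> \<not> module.dependent (ext_scale \<iota>) (set bs) \<and>
     module.span (ext_scale \<iota>) (set bs) = UNIV"

text \<open>The matrix over \<open>F\<close>, with respect to the basis \<open>bs\<close>, of the \<open>F\<close>-linear map
  \<open>y \<mapsto> x * y\<close>: column \<open>j\<close> consists of the coordinates of \<open>x * bs ! j\<close>.\<close>

definition mult_matrix :: "('f::field \<Rightarrow> 'l::field) \<Rightarrow> 'l list \<Rightarrow> 'l \<Rightarrow> 'f mat" where
  "mult_matrix \<iota> bs x = mat (length bs) (length bs)
     (\<lambda>(i, j). module.representation (ext_scale \<iota>) (set bs) (x * bs ! j) (bs ! i))"

text \<open>The norm \<open>N\<^bsub>L/F\<^esub>(x)\<close> is the determinant of \<open>y \<mapsto> x * y\<close>; it does not depend on the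
  choice of the basis. It is meaningful for finite extensions only.\<close>

definition field_norm :: "('f::field \<Rightarrow> 'l::field) \<Rightarrow> 'l \<Rightarrow> 'f" where
  "field_norm \<iota> x = det (mult_matrix \<iota> (SOME bs. ordered_basis \<iota> bs) x)"


section \<open>Forms\<close>

text \<open>A polynomial in variables \<open>X\<^sub>0, X\<^sub>1, \<dots>\<close> is a finitely supported map from monomials
  (that is, finitely supported exponent functions) to coefficients.\<close>

type_synonym 'a mpoly = "(nat \<Rightarrow>\<^sub>0 nat) \<Rightarrow>\<^sub>0 'a"

text \<open>\<open>form d p\<close>: \<open>p\<close> is homogeneous of degree \<open>d\<close> in the \<open>d\<close> variables \<open>X\<^sub>0, \<dots>, X\<^bsub>d-1\<^esub>\<close>.\<close>

definition form :: "nat \<Rightarrow> 'a::zero mpoly \<Rightarrow> bool" where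
  "form d p \<longleftrightarrow> (\<forall>m\<in>Poly_Mapping.keys p. Poly_Mapping.keys m \<subseteq> {..<d} \<and>
     (\<Sum>i<d. Poly_Mapping.lookup m i) = d)"

text \<open>The value of a polynomial at a vector; the \<open>i\<close>-th entry of the vector (counting from 0)
  is substituted for \<open>X\<^sub>i\<close>.\<close>

definition form_eval :: "'a::comm_ring_1 mpoly \<Rightarrow> 'a vec \<Rightarrow> 'a" where
  "form_eval p v = (\<Sum>m\<in>Poly_Mapping.keys p. Poly_Mapping.lookup p m *
     (\<Prod>i\<in>Poly_Mapping.keys m. v $ i ^ Poly_Mapping.lookup m i))"

text \<open>The polynomial obtained by extension of scalars along \<open>\<kappa>\<close>.\<close>

definition form_ext :: "('f::field \<Rightarrow> 'k::field) \<Rightarrow> 'f mpoly \<Rightarrow> 'k mpoly" where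
  "form_ext \<kappa> p = Poly_Mapping.map \<kappa> p"

text \<open>\<open>\<phi>\<close> is the norm of \<open>L/F\<close> in coordinates with respect to the basis
  \<open>1, \<alpha>, \<dots>, \<alpha>\<^bsup>d-1\<^esup>\<close>. When \<open>F\<close> has more than \<open>d\<close> elements, a form of degree
  \<open>d\<close> is determined by its values, so this describes \<open>\<phi>\<close> uniquely. It exists, since the entries
  of the matrix of \<open>y \<mapsto> (x\<^sub>1 + \<alpha> x\<^sub>2 + \<dots>) * y\<close> are linear forms in \<open>x\<^sub>1, x\<^sub>2, \<dots>\<close>.\<close>

definition is_norm_form :: "nat \<Rightarrow> ('f::field \<Rightarrow> 'l::field) \<Rightarrow> 'l \<Rightarrow> 'f mpoly \<Rightarrow> bool" where
  "is_norm_form d \<iota> \<alpha> \<phi> \<longleftrightarrow> form d \<phi> \<and>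
     (\<forall>x\<in>carrier_vec d. form_eval \<phi> x = field_norm \<iota> (\<Sum>i<d. \<alpha> ^ i * \<iota> (x $ i)))"

definition isometric :: "nat \<Rightarrow> ('f::field vec \<Rightarrow> 'f) \<Rightarrow> ('f vec \<Rightarrow> 'f) \<Rightarrow> bool" where
  "isometric n \<phi>\<^sub>1 \<phi>\<^sub>2 \<longleftrightarrow> (\<exists>f. bij_betw f (carrier_vec n) (carrier_vec n) \<and>
     (\<forall>u\<in>carrier_vec n. \<forall>v\<in>carrier_vec n. f (u + v) = f u + f v) \<and>
     (\<forall>a. \<forall>v\<in>carrier_vec n. f (a \<cdot>\<^sub>v v) = a \<cdot>\<^sub>v f v) \<and>
     (\<forall>v\<in>carrier_vec n. \<phi>\<^sub>2 (f v) = \<phi>\<^sub>1 v))"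

definition similarity_factors :: "nat \<Rightarrow> 'f::field mpoly \<Rightarrow> 'f set" where
  "similarity_factors n \<phi> =
     {a. a \<noteq> 0 \<and> isometric n (form_eval \<phi>) (\<lambda>v. a * form_eval \<phi> v)}"

end

theory Submission
  imports Defs
begin

text \<open>Reducing the polynomial \<open>z(X) \<sigma>z(X)\<close> modulo \<open>X\<^sup>d - b X - c\<close> gives exactly the coordinates
  in the statement; they lie in \<open>F\<close> because the coefficients of \<open>z(X) \<sigma>z(X)\<close> are fixed by \<open>\<sigma>\<close>.
  So everything reduces to \<open>N\<^bsub>K/F\<^esub>(w) = w \<sigma>(w)\<close> and to the multiplicativity of \<open>\<phi>\<^sub>K\<close> for
  the product of \<open>K[X]/(X\<^sup>d - b X - c)\<close>. The identity \<open>\<phi>(xy) = \<phi>(x) \<phi>(y)\<close> holds for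
  \<open>x, y\<close> over \<open>F\<close> and has degree at most \<open>d\<close> in each coordinate of \<open>x\<close> and \<open>y\<close>; as \<open>F\<close> has
  more than \<open>d\<close> elements, it persists over \<open>K\<close>. Finally, every nonzero value of \<open>\<phi>\<close> is a
  similarity factor, since multiplication in \<open>F(\<alpha>)\<close> scales the norm.\<close>

section \<open>Norms of field extensions\<close>

lemma det_two:
  assumes A: "A \<in> carrier_mat 2 2"
  shows "det A = A $$ (0, 0) * A $$ (1, 1) - A $$ (0, 1) * A $$ (1, 0)"
proof -
  have "det (mat_delete A 0 j) = mat_delete A 0 j $$ (0, 0)" for j
    using mat_delete_carrier[OF A, of 0 j] by (intro det_single) simp
  then show ?thesis
    using laplace_expansion_row[OF A, of 0] A
    by (simp add: numeral_2_eq_2 cofactor_def mat_delete_def)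
qed

context field_hom
begin

sublocale ext: vector_space "ext_scale hom"
  by unfold_locales (simp_all add: ext_scale_def algebra_simps hom_distribs)

section \<open>Bases and matrices of multiplication maps\<close>

lemma ordered_basis_exists:
  assumes "ext_degree hom > 0"
  shows "\<exists>bs. ordered_basis hom bs \<and> length bs = ext_degree hom"
proof -
  obtain B where B: "ext.independent B" "ext.span B = ext.span UNIV"
    using assms unfolding ext_degree_def ext.dim_def by (auto split: if_splits)
  then have "card B = ext_degree hom"
    unfolding ext_degree_def using ext.dim_eq_card[of B UNIV] by simp
  moreover from this assms have "finite B" using card_gt_0_iff by metis
  then obtain bs where "distinct bs" "set bs = B" using finite_distinct_list by metis
  ultimately show ?thesis
    using B distinct_card[of bs] by (intro exI[of _ bs]) (auto simp: ordered_basis_def)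
qed

lemma length_ordered_basis:
  assumes "ordered_basis hom bs"
  shows "length bs = ext_degree hom"
  using assms ext.dim_eq_card[of "set bs" UNIV] distinct_card[of bs]
  by (simp add: ordered_basis_def ext_degree_def)

lemma sum_nth_ordered_basis:
  assumes "ordered_basis hom bs"
  shows "(\<Sum>e\<in>set bs. f e) = (\<Sum>i<length bs. f (bs ! i))"
proof -
  have "bij_betw ((!) bs) {..<length bs} (set bs)"
    using assms by (auto simp: ordered_basis_def intro: bij_betw_nth)
  then show ?thesis by (simp add: sum.reindex_bij_betw)
qed

lemma mult_matrix_carrier [simp]:
  "mult_matrix hom bs x \<in> carrier_mat (length bs) (length bs)"
  by (simp add: mult_matrix_def)

lemma mult_matrix_column:
  assumes bs: "ordered_basis hom bs" and j: "j < length bs"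
  shows "x * bs ! j = (\<Sum>i<length bs. hom (mult_matrix hom bs x $$ (i, j)) * bs ! i)"
proof -
  have "x * bs ! j = (\<Sum>e\<in>set bs. ext_scale hom (ext.representation (set bs) (x * bs ! j) e) e)"
    using bs by (intro ext.sum_representation_eq[symmetric]) (auto simp: ordered_basis_def)
  then show ?thesis
    using j by (simp add: sum_nth_ordered_basis[OF bs] mult_matrix_def ext_scale_def)
qed

text \<open>Linear independence in indexed form: \<open>representation\<close> recovers the
  coefficient at \<open>bs ! k\<close>, because the entries of \<open>bs\<close> are
  distinct.\<close>

lemma ordered_basis_coeff_eq:
  assumes bs: "ordered_basis hom bs"
    and eq: "(\<Sum>i<length bs. hom (f i) * bs ! i) = (\<Sum>i<length bs. hom (g i) * bs ! i)"
    and k: "k < length bs"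
  shows "f k = g k"
proof -
  have *: "ext.representation (set bs) (\<Sum>i<length bs. hom (h i) * bs ! i) (bs ! k) = h k" for h
  proof -
    have ind: "ext.independent (set bs)" and sp: "\<And>v. v \<in> ext.span (set bs)"
      using bs by (auto simp: ordered_basis_def)
    have "ext.representation (set bs) (\<Sum>i<length bs. hom (h i) * bs ! i) (bs ! k)
      = (\<Sum>i<length bs. h i * ext.representation (set bs) (bs ! i) (bs ! k))"
      using ext.representation_sum[OF ind, of "{..<length bs}" "\<lambda>i. ext_scale hom (h i) (bs ! i)"] sp
        ext.representation_scale[OF ind sp, of _ "bs ! _"]
      by (simp add: ext_scale_def)
    also have "\<dots> = (\<Sum>i<length bs. if i = k then h i else 0)"
      using bs k by (intro sum.cong)
        (auto simp: ext.representation_basis[OF ind] ordered_basis_def nth_eq_iff_index_eq)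
    finally show ?thesis using k by simp
  qed
  show ?thesis using *[of f] *[of g] eq by simp
qed

text \<open>Coordinates in a basis are unique, so a matrix with the right columns is the
  multiplication matrix. The matrices of 0, 1 and products are identified in this way.\<close>

lemma mult_matrix_eqI:
  assumes bs: "ordered_basis hom bs" and M: "M \<in> carrier_mat (length bs) (length bs)"
    and col: "\<And>j. j < length bs \<Longrightarrow> x * bs ! j = (\<Sum>i<length bs. hom (M $$ (i, j)) * bs ! i)"
  shows "mult_matrix hom bs x = M"
proof (rule eq_matI)
  fix i j assume ij: "i < dim_row M" "j < dim_col M"
  then show "mult_matrix hom bs x $$ (i, j) = M $$ (i, j)"
    using M mult_matrix_column[OF bs, of j x] col[of j]
    by (intro ordered_basis_coeff_eq[OF bs, where k = i]) auto
qed (use M in \<open>auto simp: mult_matrix_def\<close>)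

lemma mult_matrix_one:
  assumes "ordered_basis hom bs"
  shows "mult_matrix hom bs 1 = 1\<^sub>m (length bs)"
proof (rule mult_matrix_eqI[OF assms])
  fix j assume j: "j < length bs"
  have "(\<Sum>i<length bs. hom (1\<^sub>m (length bs) $$ (i, j)) * bs ! i)
    = (\<Sum>i<length bs. if i = j then bs ! i else 0)"
    using j by (intro sum.cong) auto
  then show "1 * bs ! j = (\<Sum>i<length bs. hom (1\<^sub>m (length bs) $$ (i, j)) * bs ! i)"
    using j by simp
qed simp

lemma mult_matrix_mult:
  assumes bs: "ordered_basis hom bs"
  shows "mult_matrix hom bs (x * y) = mult_matrix hom bs x * mult_matrix hom bs y"
proof (rule mult_matrix_eqI[OF bs])
  let ?n = "length bs" and ?X = "mult_matrix hom bs x" and ?Y = "mult_matrix hom bs y"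
  show "?X * ?Y \<in> carrier_mat ?n ?n" by (meson mult_carrier_mat mult_matrix_carrier)
  fix j assume j: "j < ?n"
  have "x * y * bs ! j = (\<Sum>k<?n. hom (?Y $$ (k, j)) * (x * bs ! k))"
    using mult_matrix_column[OF bs j, of y] by (simp add: sum_distrib_left mult_ac)
  also have "\<dots> = (\<Sum>k<?n. \<Sum>i<?n. hom (?Y $$ (k, j)) * (hom (?X $$ (i, k)) * bs ! i))"
    by (simp add: mult_matrix_column[OF bs, of _ x] sum_distrib_left)
  also have "\<dots> = (\<Sum>i<?n. \<Sum>k<?n. hom (?Y $$ (k, j)) * (hom (?X $$ (i, k)) * bs ! i))"
    by (rule sum.swap)
  also have "\<dots> = (\<Sum>i<?n. hom ((?X * ?Y) $$ (i, j)) * bs ! i)"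
  proof (rule sum.cong)
    fix i assume "i \<in> {..<?n}"
    then have "(?X * ?Y) $$ (i, j) = (\<Sum>k<?n. ?X $$ (i, k) * ?Y $$ (k, j))"
      using j by (simp add: mult_matrix_def scalar_prod_def atLeast0LessThan)
    then show "(\<Sum>k<?n. hom (?Y $$ (k, j)) * (hom (?X $$ (i, k)) * bs ! i))
      = hom ((?X * ?Y) $$ (i, j)) * bs ! i"
      by (simp add: hom_distribs sum_distrib_right mult_ac)
  qed simp
  finally show "x * y * bs ! j = (\<Sum>i<?n. hom ((?X * ?Y) $$ (i, j)) * bs ! i)" .
qed

section \<open>Elementary properties of the norm\<close>

text \<open>Positive degree makes the choice in \<open>field_norm\<close> refer to an actual basis,
  in which the norm is then computed.\<close>

lemma field_norm_basis:
  assumes "ext_degree hom > 0"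
  obtains bs where "ordered_basis hom bs" "length bs = ext_degree hom"
    "field_norm hom = (\<lambda>x. det (mult_matrix hom bs x))"
proof
  show *: "ordered_basis hom (SOME bs. ordered_basis hom bs)"
    using ordered_basis_exists[OF assms] by (metis someI_ex)
  show "length (SOME bs. ordered_basis hom bs) = ext_degree hom"
    by (rule length_ordered_basis[OF *])
qed (simp add: fun_eq_iff field_norm_def)

lemma field_norm_one:
  assumes "ext_degree hom > 0" shows "field_norm hom 1 = 1"
proof -
  obtain bs where "ordered_basis hom bs" "field_norm hom = (\<lambda>x. det (mult_matrix hom bs x))"
    using field_norm_basis[OF assms] .
  then show ?thesis by (simp add: mult_matrix_one)
qed

lemma field_norm_zero:
  assumes "ext_degree hom > 0" shows "field_norm hom 0 = 0"
proof -
  obtain bs where "ordered_basis hom bs" and len: "length bs = ext_degree hom"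
    and N: "field_norm hom = (\<lambda>x. det (mult_matrix hom bs x))"
    using field_norm_basis[OF assms] .
  then have "mult_matrix hom bs 0 = 0\<^sub>m (length bs) (length bs)"
    by (intro mult_matrix_eqI) auto
  then show ?thesis using assms by (simp add: N len)
qed

lemma field_norm_mult:
  assumes "ext_degree hom > 0"
  shows "field_norm hom (x * y) = field_norm hom x * field_norm hom y"
proof -
  obtain bs where "ordered_basis hom bs" "field_norm hom = (\<lambda>x. det (mult_matrix hom bs x))"
    using field_norm_basis[OF assms] .
  then show ?thesis by (simp add: mult_matrix_mult det_mult[OF mult_matrix_carrier mult_matrix_carrier])
qed

section \<open>Quadratic extensions and conjugation\<close>

text \<open>The rows \<open>(e, f)\<close> and \<open>(\<sigma> e, \<sigma> f)\<close> are left
  eigenvectors of the multiplication matrix with eigenvalues \<open>x\<close> and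
  \<open>\<sigma> x\<close>. They are independent since \<open>\<sigma>\<close> is not the identity,
  so the determinant is the product of these eigenvalues.\<close>

lemma quadratic_norm:
  assumes deg: "ext_degree hom = 2"
    and "field_hom \<sigma>" and fixed: "\<And>a. \<sigma> (hom a) = hom a" and "\<sigma> \<noteq> id"
  shows "hom (field_norm hom x) = x * \<sigma> x"
proof -
  interpret s: field_hom \<sigma> by fact
  obtain bs where bs: "ordered_basis hom bs" "length bs = 2"
    and N: "field_norm hom = (\<lambda>x. det (mult_matrix hom bs x))"
    using field_norm_basis deg by (metis zero_less_numeral)
  define e f where "e = bs ! 0" and "f = bs ! 1"
  define M where "M = mult_matrix hom bs x"
  define p q r t where "p = M $$ (0, 0)" and "q = M $$ (0, 1)" and "r = M $$ (1, 0)" and "t = M $$ (1, 1)"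
  have two: "{..<2} = {0, 1 :: nat}" by auto
  have xe: "x * e = hom p * e + hom r * f" and xf: "x * f = hom q * e + hom t * f"
    using mult_matrix_column[OF bs(1), of 0 x] mult_matrix_column[OF bs(1), of 1 x] bs(2)
    by (simp_all add: two e_def f_def p_def q_def r_def t_def M_def)
  have sxe: "\<sigma> x * \<sigma> e = hom p * \<sigma> e + hom r * \<sigma> f"
    and sxf: "\<sigma> x * \<sigma> f = hom q * \<sigma> e + hom t * \<sigma> f"
    using arg_cong[OF xe, of \<sigma>] arg_cong[OF xf, of \<sigma>] by (simp_all add: hom_distribs fixed)
  have "det M = p * t - q * r"
    unfolding p_def q_def r_def t_def using bs(2) mult_matrix_carrier[of bs x]
    by (intro det_two) (simp add: M_def)
  then have det: "hom (field_norm hom x) = hom p * hom t - hom q * hom r"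
    by (simp add: N M_def hom_distribs)
  have e0: "e \<noteq> 0"
    using bs ext.dependent_zero[of "set bs"]
    by (metis e_def nth_mem ordered_basis_def zero_less_numeral)
  have span: "\<exists>a b. y = hom a * e + hom b * f" for y
  proof -
    \<comment> \<open>Multiplying \<open>e\<close> by \<open>y / e\<close> gives \<open>y\<close>,
      so the first column of the matrix of \<open>y / e\<close> holds the coordinates of
      \<open>y\<close>.\<close>
    have "y / e * e = hom (mult_matrix hom bs (y / e) $$ (0, 0)) * e
        + hom (mult_matrix hom bs (y / e) $$ (1, 0)) * f"
      using mult_matrix_column[OF bs(1), of 0 "y / e"] bs(2) by (simp add: two e_def f_def)
    then show ?thesis using e0 by auto
  qed
  \<comment> \<open>If equality held, linearity would give
    \<open>e * \<sigma> y = \<sigma> e * y\<close> for all \<open>y\<close>. Then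
    \<open>y = 1\<close> yields \<open>\<sigma> e = e\<close>, and \<open>\<sigma>\<close> would be
    the identity.\<close>
  have "e * \<sigma> f \<noteq> f * \<sigma> e"
  proof
    assume eq: "e * \<sigma> f = f * \<sigma> e"
    have lin: "e * \<sigma> y = \<sigma> e * y" for y
    proof -
      obtain a b where "y = hom a * e + hom b * f" using span by blast
      then have "e * \<sigma> y = hom a * e * \<sigma> e + hom b * (e * \<sigma> f)"
        by (simp add: hom_distribs fixed algebra_simps)
      also have "\<dots> = \<sigma> e * y"
        unfolding eq \<open>y = _\<close> by (simp add: algebra_simps)
      finally show ?thesis .
    qed
    have "\<sigma> y = y" for y using e0 lin[of y] lin[of 1] by simp
    with \<open>\<sigma> \<noteq> id\<close> show False by (auto simp: fun_eq_iff)
  qed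
  txt \<open>The matrix with rows \<open>(e, f)\<close> and \<open>(\<sigma> e, \<sigma> f)\<close> conjugates \<open>M\<close> to \<open>diag(x, \<sigma> x)\<close>.\<close>
  moreover have "(hom p * hom t - hom q * hom r) * (e * \<sigma> f - f * \<sigma> e) = x * \<sigma> x * (e * \<sigma> f - f * \<sigma> e)"
  proof -
    have "x * \<sigma> x * (e * \<sigma> f - f * \<sigma> e) = (x * e) * (\<sigma> x * \<sigma> f) - (x * f) * (\<sigma> x * \<sigma> e)"
      by (simp add: algebra_simps)
    also have "\<dots> = (hom p * hom t - hom q * hom r) * (e * \<sigma> f - f * \<sigma> e)"
      unfolding xe xf sxe sxf by (simp add: algebra_simps)
    finally show ?thesis ..
  qed
  ultimately show ?thesis by (simp add: det)
qed

text \<open>The trace is \<open>x + \<sigma> x = N(1 + x) - N(x) - 1\<close>, hence lies in the base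
  field. It is therefore fixed by \<open>\<sigma>\<close>, which forces
  \<open>\<sigma> (\<sigma> x) = x\<close>.\<close>

lemma quadratic_involution:
  assumes deg: "ext_degree hom = 2"
    and s: "field_hom \<sigma>" "\<And>a. \<sigma> (hom a) = hom a" "\<sigma> \<noteq> id"
  shows "\<sigma> (\<sigma> x) = x" and "\<exists>a. hom a = x + \<sigma> x"
proof -
  interpret s: field_hom \<sigma> by fact
  note N = quadratic_norm[OF assms]
  have "hom (field_norm hom (1 + x) - field_norm hom x - 1) = x + \<sigma> x"
    by (simp add: hom_distribs N algebra_simps)
  then obtain a where a: "hom a = x + \<sigma> x" by blast
  then show "\<exists>a. hom a = x + \<sigma> x" by blast
  have "\<sigma> (hom a) = \<sigma> x + \<sigma> (\<sigma> x)" by (simp add: a hom_distribs)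
  then show "\<sigma> (\<sigma> x) = x" unfolding s(2) using a by (simp add: add.commute)
qed

text \<open>An element fixed by \<open>\<sigma>\<close> is half of its trace.\<close>

lemma quadratic_fixed:
  assumes deg: "ext_degree hom = 2"
    and s: "field_hom \<sigma>" "\<And>a. \<sigma> (hom a) = hom a" "\<sigma> \<noteq> id"
    and "(2 :: 'a) \<noteq> 0" and "\<sigma> x = x"
  shows "\<exists>a. hom a = x"
proof -
  obtain a where "hom a = x + x" using quadratic_involution(2)[OF deg s, of x] assms by auto
  moreover have "hom 2 = 2" by (metis hom_add hom_one one_add_one)
  moreover from this have "(2 :: 'b) \<noteq> 0" using \<open>2 \<noteq> 0\<close> by (metis hom_0_iff)
  ultimately have "hom (a / 2) = x" by (simp add: hom_distribs)
  then show ?thesis by blast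
qed

text \<open>For nonzero \<open>x\<close>, multiplication by \<open>x\<close> is an injective linear
  map of \<open>S\<close> into itself. Finite dimension makes it onto, so 1 is a multiple of
  \<open>x\<close> within \<open>S\<close>.\<close>

lemma subalgebra_inverse_closed:
  assumes deg: "ext_degree hom > 0" and S: "ext.subspace S"
    and one: "1 \<in> S" and mult: "\<And>x y. x \<in> S \<Longrightarrow> y \<in> S \<Longrightarrow> x * y \<in> S"
    and x: "x \<in> S"
  shows "inverse x \<in> S"
proof (cases "x = 0")
  case True
  then show ?thesis using x by simp
next
  case False
  obtain bs where "ordered_basis hom bs" using ordered_basis_exists[OF deg] by blast
  then interpret fd: finite_dimensional_vector_space "ext_scale hom" "set bs"
    by unfold_locales (auto simp: ordered_basis_def)
  interpret m: Vector_Spaces.linear "ext_scale hom" "ext_scale hom" "(*) x"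
    by unfold_locales (simp_all add: ext_scale_def algebra_simps)
  obtain B where B: "B \<subseteq> S" "ext.independent B" "S \<subseteq> ext.span B" "card B = ext.dim S"
    using ext.basis_exists[of S] by blast
  have inj: "inj ((*) x)" using False by (simp add: inj_on_def)
  \<comment> \<open>The image of a basis of \<open>S\<close> is an independent subset of
    \<open>S\<close> with \<open>dim S\<close> elements, so it spans \<open>S\<close>.\<close>
  have "S \<subseteq> ext.span ((*) x ` B)"
  proof (rule fd.card_ge_dim_independent)
    show "(*) x ` B \<subseteq> S" using B(1) mult x by blast
    show "ext.independent ((*) x ` B)" using B(2) inj by (rule m.independent_inj_image)
    show "ext.dim S \<le> card ((*) x ` B)"
      using B(4) inj card_image[of "(*) x" B] by (metis inj_on_subset order_refl subset_UNIV)
  qed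
  also have "\<dots> = (*) x ` ext.span B" by (rule m.span_image)
  also have "\<dots> \<subseteq> (*) x ` S" using ext.span_minimal[OF B(1) S] by blast
  finally obtain y where "y \<in> S" "1 = x * y" using one by blast
  then show ?thesis by (metis inverse_unique)
qed

end

section \<open>Arithmetic modulo a trinomial\<close>

text \<open>The coefficient of \<open>X ^ k\<close> in the product of two polynomials of degree
  below \<open>d\<close>. Values of \<open>x\<close> and \<open>y\<close> at indices from
  \<open>d\<close> on are ignored, so vectors of length \<open>d\<close> can be passed as
  \<open>($) u\<close>.\<close>

definition conv :: "nat \<Rightarrow> (nat \<Rightarrow> 'a::comm_ring_1) \<Rightarrow> (nat \<Rightarrow> 'a) \<Rightarrow> nat \<Rightarrow> 'a" where
  "conv d x y k = (\<Sum>(i, j)\<in>{(i, j). i < d \<and> j < d \<and> i + j = k}. x i * y j)"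

lemma conv_add_left: "conv d (\<lambda>i. x i + x' i) y k = conv d x y k + conv d x' y k"
  by (simp add: conv_def sum.distrib[symmetric] split_def algebra_simps)

lemma conv_scale_left: "conv d (\<lambda>i. a * x i) y k = a * conv d x y k"
  by (simp add: conv_def sum_distrib_left split_def algebra_simps)

lemma conv_commute: "conv d x y k = conv d y x k"
  unfolding conv_def
  by (rule sum.reindex_bij_witness[of _ prod.swap prod.swap]) (auto simp: mult.commute)

lemma conv_cong: "(\<And>i. i < d \<Longrightarrow> x i = x' i) \<Longrightarrow> (\<And>i. i < d \<Longrightarrow> y i = y' i) \<Longrightarrow>
  conv d x y k = conv d x' y' k"
  unfolding conv_def by (rule sum.cong) auto

text \<open>The product has degree at most \<open>2 * d - 2\<close>.\<close>

lemma conv_beyond: "2 * d \<le> k + 1 \<Longrightarrow> conv d x y k = 0"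
  unfolding conv_def by (rule sum.neutral) auto

text \<open>The terms are grouped by \<open>i + j\<close>. The bound \<open>2 * d\<close> includes
  one zero coefficient, so that the sum splits into two blocks of length \<open>d\<close>.\<close>

lemma power_sum_conv:
  "(\<Sum>i<d. x i * \<beta> ^ i) * (\<Sum>j<d. y j * \<beta> ^ j) = (\<Sum>k<2 * d. conv d x y k * \<beta> ^ k)"
proof -
  let ?S = "{..<d} \<times> {..<d}" and ?h = "\<lambda>(i, j). x i * y j * \<beta> ^ (i + j)"
  have "(\<Sum>i<d. x i * \<beta> ^ i) * (\<Sum>j<d. y j * \<beta> ^ j) = sum ?h ?S"
    by (simp add: sum_product sum.cartesian_product power_add mult_ac)
  also have "\<dots> = (\<Sum>k<2 * d. sum ?h {z \<in> ?S. fst z + snd z = k})"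
    by (rule sum.group[symmetric]) auto
  also have "\<dots> = (\<Sum>k<2 * d. conv d x y k * \<beta> ^ k)"
    unfolding conv_def sum_distrib_right by (intro sum.cong) auto
  finally show ?thesis .
qed

text \<open>The product of \<open>'a[X] / (X\<^sup>d - b X - c)\<close> in coordinates with respect to \<open>1, X, \<dots>, X\<^bsup>d-1\<^esup>\<close>.\<close>

definition trinomial_mult :: "nat \<Rightarrow> 'a::comm_ring_1 \<Rightarrow> 'a \<Rightarrow> 'a vec \<Rightarrow> 'a vec \<Rightarrow> 'a vec" where
  "trinomial_mult d b c u v = vec d (\<lambda>k. conv d (($) u) (($) v) k + c * conv d (($) u) (($) v) (d + k) +
     (if k = 0 then 0 else b * conv d (($) u) (($) v) (d + k - 1)))"

lemma trinomial_mult_carrier [simp]: "trinomial_mult d b c u v \<in> carrier_vec d"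
  by (simp add: trinomial_mult_def)

lemma dim_trinomial_mult [simp]: "dim_vec (trinomial_mult d b c u v) = d"
  by (simp add: trinomial_mult_def)

lemma trinomial_mult_commute: "trinomial_mult d b c u v = trinomial_mult d b c v u"
  unfolding trinomial_mult_def conv_commute[of d "($) u" "($) v"] ..

lemma trinomial_mult_add_left:
  assumes "u \<in> carrier_vec d" "u' \<in> carrier_vec d"
  shows "trinomial_mult d b c (u + u') v = trinomial_mult d b c u v + trinomial_mult d b c u' v"
proof -
  have "conv d (($) (u + u')) (($) v) k = conv d (($) u) (($) v) k + conv d (($) u') (($) v) k" for k
    using assms by (simp add: conv_add_left[symmetric] cong: conv_cong)
  then show ?thesis by (intro eq_vecI) (simp_all add: trinomial_mult_def algebra_simps)
qed

lemma trinomial_mult_smult_left: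
  assumes "u \<in> carrier_vec d"
  shows "trinomial_mult d b c (a \<cdot>\<^sub>v u) v = a \<cdot>\<^sub>v trinomial_mult d b c u v"
proof -
  have "conv d (($) (a \<cdot>\<^sub>v u)) (($) v) k = a * conv d (($) u) (($) v) k" for k
    using assms by (simp add: conv_scale_left[symmetric] cong: conv_cong)
  then show ?thesis by (intro eq_vecI) (simp_all add: trinomial_mult_def algebra_simps)
qed

lemma sum_lessThan_add:
  fixes f :: "nat \<Rightarrow> 'a::comm_monoid_add"
  shows "(\<Sum>k<m + n. f k) = (\<Sum>k<m. f k) + (\<Sum>k<n. f (m + k))"
  by (induction n) (simp_all add: add.assoc)

text \<open>Evaluation at a root of the trinomial respects products:
  \<open>\<beta> ^ (d + k)\<close> is replaced by
  \<open>b * \<beta> ^ (k + 1) + c * \<beta> ^ k\<close>.\<close>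

lemma power_sum_trinomial_mult:
  fixes \<beta> :: "'a::comm_ring_1"
  assumes d: "d > 0" and \<beta>: "\<beta> ^ d = b * \<beta> + c"
  shows "(\<Sum>i<d. trinomial_mult d b c u v $ i * \<beta> ^ i) =
    (\<Sum>i<d. u $ i * \<beta> ^ i) * (\<Sum>i<d. v $ i * \<beta> ^ i)"
proof -
  let ?B = "conv d (($) u) (($) v)"
  obtain n where n: "d = Suc n" using d by (cases d) auto
  have "(\<Sum>i<d. u $ i * \<beta> ^ i) * (\<Sum>i<d. v $ i * \<beta> ^ i)
    = (\<Sum>k<d. ?B k * \<beta> ^ k) + (\<Sum>k<d. ?B (d + k) * (\<beta> ^ d * \<beta> ^ k))"
    by (simp add: power_sum_conv mult_2 sum_lessThan_add power_add)
  also have "(\<Sum>k<d. ?B (d + k) * (\<beta> ^ d * \<beta> ^ k))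
    = (\<Sum>k<d. c * ?B (d + k) * \<beta> ^ k) + (\<Sum>k<d. b * ?B (d + k) * \<beta> ^ Suc k)"
    unfolding \<beta> by (simp add: sum.distrib[symmetric] algebra_simps)
  \<comment> \<open>The last term has coefficient index \<open>2 * d - 1\<close>, hence vanishes.
    All remaining powers have exponent below \<open>d\<close>, so one reduction suffices.\<close>
  also have "(\<Sum>k<d. b * ?B (d + k) * \<beta> ^ Suc k) = (\<Sum>k<n. b * ?B (d + k) * \<beta> ^ Suc k)"
    using conv_beyond[of d "d + n" "($) u" "($) v"] by (simp add: n)
  also have "\<dots> = (\<Sum>k<d. (if k = 0 then 0 else b * ?B (d + k - 1)) * \<beta> ^ k)"
    by (simp add: n sum.lessThan_Suc_shift del: sum.lessThan_Suc)
  finally show ?thesis by (simp add: trinomial_mult_def sum.distrib algebra_simps)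
qed

section \<open>Coordinates with respect to the powers of \<alpha>\<close>

context field_hom
begin

lemma map_vec_trinomial_mult:
  assumes "u \<in> carrier_vec d" "v \<in> carrier_vec d"
  shows "map_vec hom (trinomial_mult d b c u v) =
    trinomial_mult d (hom b) (hom c) (map_vec hom u) (map_vec hom v)"
proof -
  have "hom (conv d (($) u) (($) v) k) = conv d (($) (map_vec hom u)) (($) (map_vec hom v)) k" for k
    unfolding conv_def hom_sum using assms by (intro sum.cong) (auto simp: hom_distribs)
  then show ?thesis by (intro eq_vecI) (simp_all add: trinomial_mult_def hom_distribs)
qed

definition power_comb :: "nat \<Rightarrow> 'b \<Rightarrow> 'a vec \<Rightarrow> 'b" where
  "power_comb d \<alpha> x = (\<Sum>i<d. \<alpha> ^ i * hom (x $ i))"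

lemma power_comb_trinomial_mult:
  assumes "d > 0" and "\<alpha> ^ d = hom b * \<alpha> + hom c"
    and "u \<in> carrier_vec d" "v \<in> carrier_vec d"
  shows "power_comb d \<alpha> (trinomial_mult d b c u v) = power_comb d \<alpha> u * power_comb d \<alpha> v"
proof -
  have "power_comb d \<alpha> w = (\<Sum>i<d. map_vec hom w $ i * \<alpha> ^ i)" if "w \<in> carrier_vec d" for w
    using that by (simp add: power_comb_def mult.commute)
  then show ?thesis
    using power_sum_trinomial_mult[OF assms(1,2), of "map_vec hom u" "map_vec hom v"] assms(3,4)
    by (simp add: map_vec_trinomial_mult[symmetric])
qed

text \<open>The trinomial relation makes the image closed under products. It is thus a
  finite-dimensional subalgebra, hence a subfield containing \<alpha>, hence everything. The
  \<open>d\<close> powers span a space of dimension \<open>d\<close>, so they form a basis, which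
  gives injectivity.\<close>

lemma power_comb_bij:
  assumes d: "d \<ge> 2" and \<alpha>: "\<alpha> ^ d = hom b * \<alpha> + hom c"
    and gen: "adjoin hom \<alpha> = UNIV" and deg: "ext_degree hom = d"
  shows "bij_betw (power_comb d \<alpha>) (carrier_vec d) UNIV"
proof -
  define S where "S = power_comb d \<alpha> ` carrier_vec d"
  have SI: "(\<Sum>i<d. \<alpha> ^ i * hom (f i)) \<in> S" for f
    unfolding S_def by (rule image_eqI[of _ _ "vec d f"]) (simp_all add: power_comb_def)
  have hS: "hom a \<in> S" for a
  proof -
    have "(\<Sum>i<d. \<alpha> ^ i * hom (if i = 0 then a else 0)) = (\<Sum>i<d. if i = 0 then hom a else 0)"
      by (rule sum.cong) auto
    then show ?thesis using SI[of "\<lambda>i. if i = 0 then a else 0"] d by simp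
  qed
  have \<alpha>S: "\<alpha> \<in> S"
  proof -
    have "(\<Sum>i<d. \<alpha> ^ i * hom (if i = 1 then 1 else 0)) = (\<Sum>i<d. if i = 1 then \<alpha> else 0)"
      by (rule sum.cong) auto
    then show ?thesis using SI[of "\<lambda>i. if i = 1 then 1 else 0"] d by simp
  qed
  have add: "x + y \<in> S" if xy: "x \<in> S" "y \<in> S" for x y
  proof -
    obtain u v where "x = power_comb d \<alpha> u" "y = power_comb d \<alpha> v" using xy S_def by blast
    then show ?thesis using SI[of "\<lambda>i. u $ i + v $ i"]
      by (simp add: power_comb_def hom_distribs sum.distrib algebra_simps)
  qed
  have mult: "x * y \<in> S" if xy: "x \<in> S" "y \<in> S" for x y
  proof -
    obtain u v where "u \<in> carrier_vec d" "v \<in> carrier_vec d"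
      "x = power_comb d \<alpha> u" "y = power_comb d \<alpha> v" using xy S_def by blast
    then have "x * y = power_comb d \<alpha> (trinomial_mult d b c u v)"
      using d \<alpha> by (simp add: power_comb_trinomial_mult)
    then show ?thesis unfolding S_def by simp
  qed
  have sub: "ext.subspace S"
    using hS[of 0] add mult hS by (auto simp: ext.subspace_def ext_scale_def)
  have "is_subfield S"
    unfolding is_subfield_def
    using hS[of 0] hS[of 1] add mult ext.subspace_neg[OF sub]
      subalgebra_inverse_closed[OF _ sub] d deg by auto
  then have UN: "S = UNIV"
    using gen hS \<alpha>S unfolding adjoin_def by blast
  define P where "P = (\<lambda>i. \<alpha> ^ i) ` {..<d}"
  have "S \<subseteq> ext.span P"
  proof
    fix x assume "x \<in> S"
    then obtain u where "x = (\<Sum>i<d. ext_scale hom (u $ i) (\<alpha> ^ i))"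
      by (auto simp: S_def power_comb_def ext_scale_def mult.commute)
    moreover have "\<alpha> ^ i \<in> ext.span P" if "i < d" for i
      by (rule ext.span_base) (use that in \<open>auto simp: P_def\<close>)
    ultimately show "x \<in> ext.span P"
      by (auto intro!: ext.span_sum ext.span_scale)
  qed
  then have span: "ext.span P = UNIV" using UN by auto
  have fin: "finite P" by (simp add: P_def)
  \<comment> \<open>A priori some powers of \<alpha> might coincide; a spanning set of a
    \<open>d\<close>-dimensional space rules this out.\<close>
  have "d \<le> card P"
    using ext.dim_le_card[of UNIV P] span fin deg by (simp add: ext_degree_def)
  moreover have "card P \<le> d" unfolding P_def using card_image_le[of "{..<d}"] by simp
  ultimately have card: "card P = d" by simp
  obtain bs where "ordered_basis hom bs" using ordered_basis_exists d deg by force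
  then interpret fd: finite_dimensional_vector_space "ext_scale hom" "set bs"
    by unfold_locales (auto simp: ordered_basis_def)
  have ind: "ext.independent P"
    using fd.card_le_dim_spanning[of P UNIV] span fin card deg by (simp add: ext_degree_def)
  define ps where "ps = map (\<lambda>i. \<alpha> ^ i) [0..<d]"
  have set: "set ps = P" by (auto simp: ps_def P_def)
  have len: "length ps = d" by (simp add: ps_def)
  have basis: "ordered_basis hom ps"
    using ind span card_distinct[of ps] card set len by (simp add: ordered_basis_def)
  have "inj_on (power_comb d \<alpha>) (carrier_vec d)"
  proof (rule inj_onI)
    fix u v assume uv: "u \<in> carrier_vec d" "v \<in> carrier_vec d" "power_comb d \<alpha> u = power_comb d \<alpha> v"
    have pc: "power_comb d \<alpha> w = (\<Sum>i<length ps. hom (w $ i) * ps ! i)" for w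
      unfolding power_comb_def len by (rule sum.cong) (auto simp: ps_def)
    show "u = v"
    proof (rule eq_vecI)
      fix k assume "k < dim_vec v"
      then show "u $ k = v $ k"
        using uv(2) by (intro ordered_basis_coeff_eq[OF basis uv(3)[unfolded pc]]) (simp add: len)
    qed (use uv in auto)
  qed
  then show ?thesis using UN by (simp add: bij_betw_def S_def)
qed

end

section \<open>Multiplicativity of the norm form after scalar extension\<close>

lemma sum_lookup_keys:
  fixes d :: nat
  assumes "Poly_Mapping.keys m \<subseteq> {..<d}"
  shows "(\<Sum>i\<in>Poly_Mapping.keys m. Poly_Mapping.lookup m i) = (\<Sum>i<d. Poly_Mapping.lookup m i)"
  using assms by (intro sum.mono_neutral_left) (auto simp: in_keys_iff)

text \<open>Every monomial has total degree \<open>d\<close>, so substituting polynomials of degree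
  at most 1 keeps the degree at most \<open>d\<close>.\<close>

lemma form_eval_affine:
  fixes p :: "'a::idom mpoly"
  assumes p: "form d p" and v: "\<And>k. k < d \<Longrightarrow> \<exists>q. degree q \<le> 1 \<and> (\<forall>t. v t $ k = poly q t)"
  shows "\<exists>q. degree q \<le> d \<and> (\<forall>t. form_eval p (v t) = poly q t)"
proof -
  obtain q where q: "\<And>k. k < d \<Longrightarrow> degree (q k) \<le> 1" "\<And>k t. k < d \<Longrightarrow> v t $ k = poly (q k) t"
    using v by metis
  define r where "r = (\<Sum>m\<in>Poly_Mapping.keys p. smult (Poly_Mapping.lookup p m)
    (\<Prod>i\<in>Poly_Mapping.keys m. q i ^ Poly_Mapping.lookup m i))"
  have k: "Poly_Mapping.keys m \<subseteq> {..<d}"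
    and s: "(\<Sum>i<d. Poly_Mapping.lookup m i) = d" if "m \<in> Poly_Mapping.keys p" for m
    using p that by (auto simp: form_def)
  have "degree r \<le> d"
    unfolding r_def
  proof (rule degree_sum_le)
    fix m assume m: "m \<in> Poly_Mapping.keys p"
    have "degree (\<Prod>i\<in>Poly_Mapping.keys m. q i ^ Poly_Mapping.lookup m i)
      \<le> (\<Sum>i\<in>Poly_Mapping.keys m. degree (q i ^ Poly_Mapping.lookup m i))"
      using degree_prod_sum_le[of "Poly_Mapping.keys m" "\<lambda>i. q i ^ Poly_Mapping.lookup m i"]
      by (simp add: o_def)
    also have "\<dots> \<le> (\<Sum>i\<in>Poly_Mapping.keys m. Poly_Mapping.lookup m i)"
    proof (rule sum_mono)
      fix i assume "i \<in> Poly_Mapping.keys m"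
      then have "degree (q i) \<le> 1" using q(1) k[OF m] by auto
      then show "degree (q i ^ Poly_Mapping.lookup m i) \<le> Poly_Mapping.lookup m i"
        using degree_power_le[of "q i" "Poly_Mapping.lookup m i"]
          mult_le_mono1[of "degree (q i)" 1 "Poly_Mapping.lookup m i"] by linarith
    qed
    also have "\<dots> = d" using sum_lookup_keys[OF k[OF m]] s[OF m] by simp
    finally show "degree (smult (Poly_Mapping.lookup p m)
        (\<Prod>i\<in>Poly_Mapping.keys m. q i ^ Poly_Mapping.lookup m i)) \<le> d"
      using degree_smult_le order_trans by blast
  qed simp
  moreover have "form_eval p (v t) = poly r t" for t
    unfolding form_eval_def r_def poly_sum poly_smult poly_prod poly_power
    using k q(2)
    by (intro sum.cong arg_cong2[of _ _ _ _ "(*)"] prod.cong arg_cong2[of _ _ _ _ power])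
      (auto simp: subset_iff)
  ultimately show ?thesis by blast
qed

text \<open>Coordinates are released from \<open>S\<close> one at a time: a polynomial of degree at
  most \<open>n\<close> in the released coordinate vanishes on more than \<open>n\<close> points,
  hence identically.\<close>

lemma separately_poly_vanish:
  fixes g :: "(nat \<Rightarrow> 'a::idom) \<Rightarrow> 'a"
  assumes S: "card S > n"
    and poly: "\<And>x i. i < d \<Longrightarrow> \<exists>q. degree q \<le> n \<and> (\<forall>t. g (x(i := t)) = poly q t)"
    and vanish: "\<And>x. (\<And>i. i < d \<Longrightarrow> x i \<in> S) \<Longrightarrow> g x = 0"
  shows "g x = 0"
proof -
  have "m \<le> d \<Longrightarrow> (\<And>i. m \<le> i \<Longrightarrow> i < d \<Longrightarrow> x i \<in> S) \<Longrightarrow> g x = 0" for m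
  proof (induction m arbitrary: x)
    case 0
    then show ?case using vanish by simp
  next
    case (Suc m)
    obtain q where q: "degree q \<le> n" "\<And>t. g (x(m := t)) = poly q t"
      using poly[of m x] Suc.prems(1) by auto
    have "poly q t = 0" if "t \<in> S" for t
      unfolding q(2)[symmetric] by (rule Suc.IH) (use Suc.prems that in \<open>auto simp: le_Suc_eq Suc_le_eq\<close>)
    then have S_roots: "S \<subseteq> {t. poly q t = 0}" by blast
    have "q = 0"
    proof (rule ccontr)
      assume "q \<noteq> 0"
      then have "card S \<le> degree q"
        using card_mono[OF poly_roots_finite S_roots] card_poly_roots_bound[of q] order_trans by blast
      then show False using q(1) S by simp
    qed
    then show ?case using q(2)[of "x m"] by simp
  qed
  from this[of d] show ?thesis by simp
qed

text \<open>Changing one entry moves along a line, to which bilinearity of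
  \<open>trinomial_mult\<close> applies.\<close>

lemma vec_fun_upd_affine:
  fixes x :: "nat \<Rightarrow> 'a::comm_ring_1"
  shows "vec d (x(i := t)) = vec d (x(i := 0)) + t \<cdot>\<^sub>v vec d ((\<lambda>_. 0)(i := 1))"
  by (intro eq_vecI) auto

text \<open>Distinct numbers up to \<open>d\<close> differ by a positive number at most
  \<open>d\<close>, which the characteristic does not divide.\<close>

lemma card_of_nat_image:
  assumes "CHAR('a::comm_ring_1) = 0 \<or> CHAR('a) > d"
  shows "card ((of_nat :: nat \<Rightarrow> 'a) ` {..d}) = Suc d"
proof -
  have "inj_on (of_nat :: nat \<Rightarrow> 'a) {..d}"
  proof (rule linorder_inj_onI')
    fix m n :: nat assume mn: "m \<in> {..d}" "n \<in> {..d}" "m < n"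
    then have "0 < n - m" "n - m \<le> d" by auto
    then have "\<not> CHAR('a) dvd n - m"
      using assms nat_dvd_not_less[of "n - m" "CHAR('a)"] by auto
    then show "(of_nat m :: 'a) \<noteq> of_nat n"
      using of_nat_eq_iff_char_dvd[OF mn(3), where 'a = 'a] by simp
  qed
  then show ?thesis by (simp add: card_image)
qed

lemma form_eval_fun_upd:
  fixes p :: "'a::idom mpoly"
  assumes "form d p"
  shows "\<exists>q. degree q \<le> d \<and> (\<forall>t. form_eval p (vec d (x(i := t))) = poly q t)"
proof (rule form_eval_affine[OF assms])
  fix k assume "k < d"
  then show "\<exists>q. degree q \<le> 1 \<and> (\<forall>t. vec d (x(i := t)) $ k = poly q t)"
    by (intro exI[of _ "if k = i then [:0, 1:] else [:x k:]"]) auto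
qed

lemma trinomial_mult_affine:
  assumes "k < d" "u \<in> carrier_vec d" "w \<in> carrier_vec d"
  shows "\<exists>a e. \<forall>t. trinomial_mult d b c (u + t \<cdot>\<^sub>v w) v $ k = a + t * e"
  using assms by (intro exI[of _ "trinomial_mult d b c u v $ k"] exI[of _ "trinomial_mult d b c w v $ k"])
    (simp add: trinomial_mult_add_left trinomial_mult_smult_left)

lemma form_eval_trinomial_mult_fun_upd:
  fixes p :: "'a::idom mpoly"
  assumes "form d p"
  shows "\<exists>q. degree q \<le> d \<and>
    (\<forall>t. form_eval p (trinomial_mult d b c (vec d (x(i := t))) v) = poly q t)"
proof (rule form_eval_affine[OF assms])
  fix k assume k: "k < d"
  obtain a e where "\<forall>t. trinomial_mult d b c (vec d (x(i := 0)) + t \<cdot>\<^sub>v vec d ((\<lambda>_. 0)(i := 1))) v $ k = a + t * e"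
    using trinomial_mult_affine[OF k vec_carrier vec_carrier] by blast
  then have "\<forall>t. trinomial_mult d b c (vec d (x(i := t))) v $ k = a + t * e"
    by (subst vec_fun_upd_affine)
  then show "\<exists>q. degree q \<le> 1 \<and> (\<forall>t. trinomial_mult d b c (vec d (x(i := t))) v $ k = poly q t)"
    by (intro exI[of _ "[:a, e:]"]) simp
qed

text \<open>With \<open>v\<close> fixed, the defect of multiplicativity is a polynomial of degree at
  most \<open>d\<close> in each coordinate of \<open>u\<close> and vanishes when all coordinates lie
  in \<open>S\<close>.\<close>

lemma multiplicative_extend_left:
  fixes p :: "'a::idom mpoly"
  assumes p: "form d p" and S: "card S > d"
    and mult: "\<And>u. u \<in> carrier_vec d \<Longrightarrow> (\<And>i. i < d \<Longrightarrow> u $ i \<in> S) \<Longrightarrow>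
      form_eval p (trinomial_mult d b c u v) = form_eval p u * form_eval p v"
    and u: "u \<in> carrier_vec d"
  shows "form_eval p (trinomial_mult d b c u v) = form_eval p u * form_eval p v"
proof -
  \<comment> \<open>The defect takes a coefficient function, so that \<open>x(i := t)\<close> varies
    a single coordinate.\<close>
  define g where "g x = form_eval p (trinomial_mult d b c (vec d x) v) -
    form_eval p (vec d x) * form_eval p v" for x
  have "g (($) u) = 0"
  proof (rule separately_poly_vanish[where g = g and d = d, OF S])
    fix x i
    obtain q r where "degree q \<le> d" "degree r \<le> d"
      "\<And>t. form_eval p (trinomial_mult d b c (vec d (x(i := t))) v) = poly q t"
      "\<And>t. form_eval p (vec d (x(i := t))) = poly r t"
      using form_eval_fun_upd[OF p, of x i] form_eval_trinomial_mult_fun_upd[OF p, of b c x i v] by metis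
    then show "\<exists>s. degree s \<le> d \<and> (\<forall>t. g (x(i := t)) = poly s t)"
      by (intro exI[of _ "q - smult (form_eval p v) r"])
        (auto simp: g_def intro!: degree_diff_le order_trans[OF degree_smult_le])
  qed (simp add: g_def mult)
  moreover have "vec d (($) u) = u" using u by (intro eq_vecI) auto
  ultimately show ?thesis by (simp add: g_def)
qed

section \<open>Forms under extension of scalars\<close>

context field_hom
begin

lemma lookup_form_ext [simp]: "Poly_Mapping.lookup (form_ext hom p) m = hom (Poly_Mapping.lookup p m)"
  by (simp add: form_ext_def Poly_Mapping.map.rep_eq when_def)

text \<open>A field homomorphism is injective, so no coefficient becomes zero.\<close>

lemma keys_form_ext [simp]: "Poly_Mapping.keys (form_ext hom p) = Poly_Mapping.keys p"
  by (auto simp: in_keys_iff)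

lemma form_form_ext: "form d p \<Longrightarrow> form d (form_ext hom p)"
  by (simp add: form_def)

lemma form_eval_form_ext:
  assumes "form d p" "v \<in> carrier_vec d"
  shows "form_eval (form_ext hom p) (map_vec hom v) = hom (form_eval p v)"
proof -
  have "i < dim_vec v" if "m \<in> Poly_Mapping.keys p" "i \<in> Poly_Mapping.keys m" for m i
    using assms that by (auto simp: form_def)
  then show ?thesis
    unfolding form_eval_def keys_form_ext lookup_form_ext hom_sum hom_mult hom_prod hom_power
    by (intro sum.cong arg_cong2[of _ _ _ _ "(*)"] prod.cong) auto
qed

lemma form_eval_form_ext_automorphism:
  assumes "field_hom \<sigma>" and fixed: "\<And>a. \<sigma> (hom a) = hom a"
    and "form d p" "v \<in> carrier_vec d"
  shows "\<sigma> (form_eval (form_ext hom p) v) = form_eval (form_ext hom p) (map_vec \<sigma> v)"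
proof -
  interpret s: field_hom \<sigma> by fact
  \<comment> \<open>The coefficients come from the base field, so \<open>\<sigma>\<close> fixes the
    form and acts on the arguments only.\<close>
  have "form_ext \<sigma> (form_ext hom p) = form_ext hom p"
    by (rule poly_mapping_eqI) (simp add: fixed)
  then show ?thesis
    using s.form_eval_form_ext[OF form_form_ext[OF assms(3)] assms(4)] by simp
qed

lemma form_ext_multiplicative:
  assumes p: "form d p" and char: "CHAR('a) = 0 \<or> CHAR('a) > d"
    and mult: "\<And>u v. u \<in> carrier_vec d \<Longrightarrow> v \<in> carrier_vec d \<Longrightarrow>
      form_eval p (trinomial_mult d b c u v) = form_eval p u * form_eval p v"
    and u: "u \<in> carrier_vec d" and v: "v \<in> carrier_vec d"
  shows "form_eval (form_ext hom p) (trinomial_mult d (hom b) (hom c) u v) =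
    form_eval (form_ext hom p) u * form_eval (form_ext hom p) v"
proof -
  \<comment> \<open>A set of \<open>d + 1\<close> elements of the base field, one more than the
    degree bound.\<close>
  define S where "S = hom ` of_nat ` {..d}"
  let ?P = "form_ext hom p" and ?T = "trinomial_mult d (hom b) (hom c)"
  have S: "card S > d"
    unfolding S_def using card_of_nat_image[OF char] card_image[of hom] inj_f
    by (metis inj_on_subset lessI subset_UNIV)
  have P: "form d ?P" using p by (rule form_form_ext)
  have base: "form_eval ?P (?T u v) = form_eval ?P u * form_eval ?P v"
    if uv: "u \<in> carrier_vec d" "\<And>i. i < d \<Longrightarrow> u $ i \<in> S"
      "v \<in> carrier_vec d" "\<And>i. i < d \<Longrightarrow> v $ i \<in> S" for u v
  proof -
    have *: "\<exists>w\<in>carrier_vec d. x = map_vec hom w" if x: "x \<in> carrier_vec d" "\<And>i. i < d \<Longrightarrow> x $ i \<in> S" for x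
    proof -
      have "\<forall>i<d. \<exists>a. x $ i = hom a" using x(2) by (auto simp: S_def)
      then obtain f where "\<And>i. i < d \<Longrightarrow> x $ i = hom (f i)" by metis
      then show ?thesis using x(1) by (intro bexI[of _ "vec d f"] eq_vecI) auto
    qed
    obtain u' where "u' \<in> carrier_vec d" "u = map_vec hom u'" using *[OF uv(1,2)] by blast
    moreover obtain v' where "v' \<in> carrier_vec d" "v = map_vec hom v'" using *[OF uv(3,4)] by blast
    ultimately show ?thesis
      by (simp add: form_eval_form_ext[OF p] map_vec_trinomial_mult[symmetric] mult hom_distribs)
  qed
  \<comment> \<open>The first factor becomes arbitrary while the second still has its entries in
    \<open>S\<close>.\<close>
  have half: "form_eval ?P (?T u v) = form_eval ?P u * form_eval ?P v"
    if "u \<in> carrier_vec d" and "v \<in> carrier_vec d" "\<And>i. i < d \<Longrightarrow> v $ i \<in> S" for u v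
    by (rule multiplicative_extend_left[OF P S base[OF _ _ that(2,3)] that(1)])
  \<comment> \<open>The second factor is released by the same lemma after exchanging the
    factors.\<close>
  have "form_eval ?P (?T v u) = form_eval ?P v * form_eval ?P u"
  proof (rule multiplicative_extend_left[OF P S _ v])
    fix w assume "w \<in> carrier_vec d" "\<And>i. i < d \<Longrightarrow> w $ i \<in> S"
    then have "form_eval ?P (?T u w) = form_eval ?P u * form_eval ?P w"
      by (rule half[OF u])
    then show "form_eval ?P (?T w u) = form_eval ?P w * form_eval ?P u"
      by (subst trinomial_mult_commute) (simp add: mult.commute)
  qed
  then show ?thesis by (subst trinomial_mult_commute) (simp add: mult.commute)
qed

end

section \<open>Similarity factors\<close>

text \<open>\<open>power_comb\<close> carries \<open>trinomial_mult\<close> to the product of the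
  extension, where the norm is multiplicative.\<close>

lemma norm_form_multiplicative:
  assumes "field_hom \<iota>" and deg: "ext_degree \<iota> = d" "d > 0"
    and \<alpha>: "\<alpha> ^ d = \<iota> b * \<alpha> + \<iota> c" and \<phi>: "is_norm_form d \<iota> \<alpha> \<phi>"
    and uv: "u \<in> carrier_vec d" "v \<in> carrier_vec d"
  shows "form_eval \<phi> (trinomial_mult d b c u v) = form_eval \<phi> u * form_eval \<phi> v"
proof -
  interpret i: field_hom \<iota> by fact
  have "form_eval \<phi> w = field_norm \<iota> (i.power_comb d \<alpha> w)" if "w \<in> carrier_vec d" for w
    using \<phi> that by (simp add: is_norm_form_def i.power_comb_def)
  then show ?thesis
    using uv deg by (simp add: i.power_comb_trinomial_mult[OF deg(2) \<alpha>] i.field_norm_mult)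
qed

lemma norm_form_value_similarity_factor:
  assumes "field_hom \<iota>" and gen: "adjoin \<iota> \<alpha> = UNIV" and deg: "ext_degree \<iota> = d" "d \<ge> 2"
    and \<alpha>: "\<alpha> ^ d = \<iota> b * \<alpha> + \<iota> c" and \<phi>: "is_norm_form d \<iota> \<alpha> \<phi>"
    and u: "u \<in> carrier_vec d" and nz: "form_eval \<phi> u \<noteq> 0"
  shows "form_eval \<phi> u \<in> similarity_factors d \<phi>"
proof -
  interpret i: field_hom \<iota> by fact
  let ?\<theta> = "i.power_comb d \<alpha>" and ?T = "trinomial_mult d b c"
  have d: "d > 0" using deg by simp
  have bij: "bij_betw ?\<theta> (carrier_vec d) UNIV" by (rule i.power_comb_bij[OF deg(2) \<alpha> gen deg(1)])
  have \<theta>_mult: "?\<theta> (?T x y) = ?\<theta> x * ?\<theta> y" if "x \<in> carrier_vec d" "y \<in> carrier_vec d" for x y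
    by (rule i.power_comb_trinomial_mult[OF d \<alpha> that])
  have norm: "form_eval \<phi> w = field_norm \<iota> (?\<theta> w)" if "w \<in> carrier_vec d" for w
    using \<phi> that by (simp add: is_norm_form_def i.power_comb_def)
  have \<phi>_mult: "form_eval \<phi> (?T x y) = form_eval \<phi> x * form_eval \<phi> y"
    if "x \<in> carrier_vec d" "y \<in> carrier_vec d" for x y
    by (rule norm_form_multiplicative[OF assms(1) deg(1) d \<alpha> \<phi> that])
  have pos: "ext_degree \<iota> > 0" using deg by simp
  have "?\<theta> u \<noteq> 0"
    using nz norm[OF u] i.field_norm_zero[OF pos] by auto
  \<comment> \<open>\<open>v\<close> is the coordinate vector of the inverse of the element given by
    \<open>u\<close>.\<close>
  moreover obtain v where v: "v \<in> carrier_vec d" "?\<theta> v = inverse (?\<theta> u)"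
    using bij by (metis UNIV_I bij_betw_iff_bijections)
  ultimately have \<theta>_inv: "?\<theta> u * ?\<theta> v = 1" by simp
  then have one: "form_eval \<phi> u * form_eval \<phi> v = 1"
    using u v(1) pos
    by (simp add: norm i.field_norm_mult[symmetric] i.field_norm_one)
  have inv: "?T x (?T y w) = w"
    if "x \<in> carrier_vec d" "y \<in> carrier_vec d" "?\<theta> x * ?\<theta> y = 1" "w \<in> carrier_vec d" for x y w
  proof -
    have "?\<theta> (?T x (?T y w)) = ?\<theta> w"
      using that by (simp add: \<theta>_mult mult.assoc[symmetric])
    then show ?thesis
      using bij that(4) by (auto simp: bij_betw_def dest!: inj_onD)
  qed
  have "isometric d (form_eval \<phi>) (\<lambda>w. form_eval \<phi> u * form_eval \<phi> w)"
    unfolding isometric_def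
  \<comment> \<open>The factor \<open>form_eval \<phi> u\<close> stands on the target form, so the
    isometry is multiplication by the inverse; multiplication by \<open>u\<close> undoes it.\<close>
  proof (intro exI[of _ "?T v"] conjI ballI allI)
    show "bij_betw (?T v) (carrier_vec d) (carrier_vec d)"
      by (rule bij_betw_byWitness[of _ "?T u"])
        (use inv[OF u v(1)] inv[OF v(1) u] \<theta>_inv in \<open>auto simp: mult.commute\<close>)
    show "?T v (x + y) = ?T v x + ?T v y" if "x \<in> carrier_vec d" "y \<in> carrier_vec d" for x y
      using trinomial_mult_add_left[OF that] by (simp only: trinomial_mult_commute[of d b c v])
    show "?T v (a \<cdot>\<^sub>v x) = a \<cdot>\<^sub>v ?T v x" if "x \<in> carrier_vec d" for a x
      using trinomial_mult_smult_left[OF that] by (simp only: trinomial_mult_commute[of d b c v])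
    show "form_eval \<phi> u * form_eval \<phi> (?T v x) = form_eval \<phi> x" if "x \<in> carrier_vec d" for x
      using one by (simp add: \<phi>_mult[OF v(1) that] mult.assoc[symmetric])
  qed
  then show ?thesis using nz by (simp add: similarity_factors_def)
qed

section \<open>The product of z with its conjugate in coordinates\<close>

text \<open>Indices starting from 1 belong to exponents starting from 0, so exponent sum
  \<open>k\<close> becomes index sum \<open>k + 2\<close>.\<close>

lemma conv_shift:
  "conv d (\<lambda>i. x (i + 1)) (\<lambda>j. y (j + 1)) k =
    (\<Sum>(i, j)\<in>{(i, j). i \<in> {1..d} \<and> j \<in> {1..d} \<and> i + j = k + 2}. x i * y j)"
  unfolding conv_def
  by (rule sum.reindex_bij_witness[of _ "\<lambda>(i, j). (i - 1, j - 1)" "\<lambda>(i, j). (i + 1, j + 1)"]) auto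

theorem theorem3:
  fixes d :: nat
    and \<iota> :: "'f::field \<Rightarrow> 'e::field" and \<alpha> :: 'e and b c :: 'f
    and \<phi> :: "'f mpoly"
    and \<kappa> :: "'f \<Rightarrow> 'k::field" and \<sigma> :: "'k \<Rightarrow> 'k"
    and z :: "nat \<Rightarrow> 'k"
  assumes "d \<ge> 2"
    and "CHAR('f) = 0 \<or> CHAR('f) > d"
    and "field_hom \<iota>" and "adjoin \<iota> \<alpha> = UNIV" and "ext_degree \<iota> = d"
    and "\<alpha> ^ d = \<iota> b * \<alpha> + \<iota> c"
    and "is_norm_form d \<iota> \<alpha> \<phi>"
    and "field_hom \<kappa>" and "ext_degree \<kappa> = 2"
    and "field_hom \<sigma>" and "bij \<sigma>" and "\<And>a. \<sigma> (\<kappa> a) = \<kappa> a" and "\<sigma> \<noteq> id"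
  shows "\<exists>A :: nat \<Rightarrow> 'f.
    (\<forall>k \<le> d - 1. \<kappa> (A (2 * k)) =
       (\<Sum>(i, j) \<in> {(i, j). i \<in> {1..d} \<and> j \<in> {1..d} \<and> i + j = k + 2}. z i * \<sigma> (z j))) \<and>
    (\<forall>k \<le> d - 2. \<kappa> (A (2 * k + 1)) =
       (\<Sum>(i, j) \<in> {(i, j). i \<in> {1..d} \<and> j \<in> {1..d} \<and> i + j = d + k + 2}. z i * \<sigma> (z j))) \<and>
    field_norm \<kappa> (form_eval (form_ext \<kappa> \<phi>) (vec d (\<lambda>i. z (i + 1)))) =
      form_eval \<phi> (vec d (\<lambda>k.
        if k = 0 then A 0 + c * A 1
        else if k = d - 1 then A (2 * d - 2) + b * A (2 * d - 3)
        else A (2 * k) + c * A (2 * k + 1) + b * A (2 * k - 1))) \<and>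
    (form_eval (form_ext \<kappa> \<phi>) (vec d (\<lambda>i. z (i + 1))) \<noteq> 0 \<longrightarrow>
      field_norm \<kappa> (form_eval (form_ext \<kappa> \<phi>) (vec d (\<lambda>i. z (i + 1)))) \<in> similarity_factors d \<phi>)"
proof -
  interpret \<kappa>: field_hom \<kappa> by fact
  interpret \<sigma>: field_hom \<sigma> by fact
  note quad = assms(9,10,12,13)
  have form: "form d \<phi>" using assms(7) by (simp add: is_norm_form_def)
  have d: "d > 0" using assms(1) by simp
  \<comment> \<open>Since \<open>d \<ge> 2\<close>, the assumption on the characteristic excludes
    2.\<close>
  have "(2 :: 'f) \<noteq> 0"
  proof
    assume "(2 :: 'f) = 0"
    then have "CHAR('f) dvd 2" using of_nat_eq_0_iff_char_dvd[of 2, where 'a = 'f] by simp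
    then show False using assms(1,2) dvd_imp_le[of "CHAR('f)" 2] by auto
  qed
  define x where "x = (\<lambda>i. z (i + 1))"
  define B where "B k = conv d x (\<lambda>i. \<sigma> (x i)) k" for k
  have B_sum: "B k = (\<Sum>(i, j) \<in> {(i, j). i \<in> {1..d} \<and> j \<in> {1..d} \<and> i + j = k + 2}. z i * \<sigma> (z j))" for k
    unfolding B_def x_def by (rule conv_shift)
  \<comment> \<open>As an involution, \<open>\<sigma>\<close> merely swaps the two convolved
    sequences.\<close>
  have "\<sigma> (B k) = B k" for k
  proof -
    have "\<sigma> (B k) = conv d (\<lambda>i. \<sigma> (x i)) x k"
      unfolding B_def conv_def \<sigma>.hom_sum
      by (intro sum.cong) (auto simp: \<sigma>.hom_mult \<kappa>.quadratic_involution(1)[OF quad])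
    then show ?thesis by (simp add: B_def conv_commute[of d x])
  qed
  then have "\<forall>k. \<exists>a. \<kappa> a = B k"
    using \<kappa>.quadratic_fixed[OF quad \<open>2 \<noteq> 0\<close>] by blast
  then obtain C where C: "\<And>k. \<kappa> (C k) = B k" by metis
  \<comment> \<open>Even indices carry the coefficients of the product from exponent 0 on, odd
    indices those from exponent \<open>d\<close> on, which get reduced.\<close>
  define A where "A n = (if even n then C (n div 2) else C (d + n div 2))" for n
  have A_even: "\<kappa> (A (2 * k)) = B k" and A_odd: "\<kappa> (A (2 * k + 1)) = B (d + k)" for k
    by (simp_all add: A_def C)
  define w where "w = vec d (\<lambda>k.
        if k = 0 then A 0 + c * A 1
        else if k = d - 1 then A (2 * d - 2) + b * A (2 * d - 3)
        else A (2 * k) + c * A (2 * k + 1) + b * A (2 * k - 1))"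
  let ?x = "vec d x" and ?\<phi>K = "form_eval (form_ext \<kappa> \<phi>)"
  have w_eq: "map_vec \<kappa> w = trinomial_mult d (\<kappa> b) (\<kappa> c) ?x (map_vec \<sigma> ?x)"
  proof (rule eq_vecI)
    fix k assume "k < dim_vec (trinomial_mult d (\<kappa> b) (\<kappa> c) ?x (map_vec \<sigma> ?x))"
    then have k: "k < d" by simp
    have conv: "conv d (($) ?x) (($) (map_vec \<sigma> ?x)) m = B m" for m
      unfolding B_def by (rule conv_cong) auto
    have "\<kappa> (w $ k) = B k + \<kappa> c * B (d + k) + (if k = 0 then 0 else \<kappa> b * B (d + k - 1))"
    proof (cases k)
      case 0
      then show ?thesis
        using k A_even[of 0] A_odd[of 0] by (simp add: w_def \<kappa>.hom_add \<kappa>.hom_mult)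
    next
      case (Suc m)
      have odd: "\<kappa> (A (2 * k - 1)) = B (d + k - 1)"
        using A_odd[of m] Suc by simp
      show ?thesis
      proof (cases "k = d - 1")
        case True
        \<comment> \<open>Here \<open>d + k = 2 * d - 1\<close> exceeds the degree of the product;
          this is why the last coordinate has no \<open>c\<close> term.\<close>
        then have "B (d + k) = 0" unfolding B_def by (intro conv_beyond) simp
        moreover have "2 * d - 2 = 2 * k" "2 * d - 3 = 2 * k - 1" using True by auto
        ultimately show ?thesis
          using k Suc True A_even[of k] odd
          by (simp add: w_def \<kappa>.hom_add \<kappa>.hom_mult del: mult_Suc_right)
      next
        case False
        then show ?thesis
          using k Suc A_even[of k] A_odd[of k] odd
          by (simp add: w_def \<kappa>.hom_add \<kappa>.hom_mult del: mult_Suc_right)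
      qed
    qed
    moreover have "map_vec \<kappa> w $ k = \<kappa> (w $ k)" using k by (simp add: w_def)
    ultimately show "map_vec \<kappa> w $ k = trinomial_mult d (\<kappa> b) (\<kappa> c) ?x (map_vec \<sigma> ?x) $ k"
      using k by (simp add: trinomial_mult_def conv)
  qed (simp add: w_def)
  have w: "w \<in> carrier_vec d" by (simp add: w_def)
  have "\<kappa> (field_norm \<kappa> (?\<phi>K ?x)) = ?\<phi>K ?x * \<sigma> (?\<phi>K ?x)"
    by (rule \<kappa>.quadratic_norm[OF quad])
  also have "\<dots> = ?\<phi>K ?x * ?\<phi>K (map_vec \<sigma> ?x)"
    using \<kappa>.form_eval_form_ext_automorphism[OF assms(10,12) form] by simp
  also have "\<dots> = ?\<phi>K (trinomial_mult d (\<kappa> b) (\<kappa> c) ?x (map_vec \<sigma> ?x))"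
    by (rule \<kappa>.form_ext_multiplicative[OF form assms(2), symmetric])
      (simp_all add: norm_form_multiplicative[OF assms(3,5) d assms(6,7)])
  also have "\<dots> = \<kappa> (form_eval \<phi> w)"
    unfolding w_eq[symmetric] by (rule \<kappa>.form_eval_form_ext[OF form w])
  finally have norm: "field_norm \<kappa> (?\<phi>K ?x) = form_eval \<phi> w" by simp
  have "field_norm \<kappa> (?\<phi>K ?x) \<in> similarity_factors d \<phi>" if "?\<phi>K ?x \<noteq> 0"
  proof -
    \<comment> \<open>The norm is the product of a nonzero element and its conjugate, which is
      nonzero because \<open>\<sigma>\<close> is injective.\<close>
    have "\<kappa> (field_norm \<kappa> (?\<phi>K ?x)) \<noteq> 0"
      using that by (simp add: \<kappa>.quadratic_norm[OF quad] del: \<kappa>.hom_0_iff)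
    then have "form_eval \<phi> w \<noteq> 0" unfolding norm by simp
    then show ?thesis
      unfolding norm
      by (rule norm_form_value_similarity_factor[OF assms(3,4,5,1,6,7) w])
  qed
  with norm have "field_norm \<kappa> (?\<phi>K ?x) = form_eval \<phi> w \<and>
      (?\<phi>K ?x \<noteq> 0 \<longrightarrow> field_norm \<kappa> (?\<phi>K ?x) \<in> similarity_factors d \<phi>)" by blast
  moreover have "\<forall>k \<le> d - 1. \<kappa> (A (2 * k)) =
       (\<Sum>(i, j) \<in> {(i, j). i \<in> {1..d} \<and> j \<in> {1..d} \<and> i + j = k + 2}. z i * \<sigma> (z j))"
    unfolding A_even B_sum by blast
  moreover have "\<forall>k \<le> d - 2. \<kappa> (A (2 * k + 1)) =
       (\<Sum>(i, j) \<in> {(i, j). i \<in> {1..d} \<and> j \<in> {1..d} \<and> i + j = d + k + 2}. z i * \<sigma> (z j))"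
    unfolding A_odd B_sum by blast
  ultimately show ?thesis unfolding w_def x_def by blast
qed

end
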